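(* Let $\mathcal{M}$ and $\mathcal{M}'$ be Kripke models, let $w$ be a state of $\mathcal{M}$ and $w'$ a state of $\mathcal{M}'$. Then $$(\mathcal{M},w)\equiv_{\mathcal{L}(\nabla)}(\mathcal{M}',w')\iff (ue(\mathcal{M}),\pi_w)\mathrel{\underline{\leftrightarrow}}_\Delta(ue(\mathcal{M}'),\pi_{w'}),$$ where $ue(\cdot)$ is the ($\forall$-version) ultrafilter extension for contingency logic, $\equiv_{\mathcal{L}(\nabla)}$ is $\mathcal{L}(\nabla)$-equivalence and $\underline{\leftrightarrow}_\Delta$ is $\Delta$-bisimilarity.
   Context: A Kripke model is $\mathcal{M}=\langle S,R,V\rangle$ with $S\neq\emptyset$, $R\subseteq S\times S$, $V:\mathbf{P}\to\mathcal{P}(S)$, where $\mathbf{P}$ is the set of propositional variables. $\mathcal{L}(\nabla)$ is the propositional language with $\neg,\wedge$ and a unary operator $\nabla$ (contingency); $\Delta\phi$ abbreviates $\neg\nabla\phi$. Semantics: $\mathcal{M},s\vDash\nabla\phi$ iff there are $t,u\in S$ with $Rst$, $Rsu$, $\mathcal{M},t\vDash\phi$ and $\mathcal{M},u\nvDash\phi$; Booleans as usual. $(\mathcal{M},w)\equiv_{\mathcal{L}(\nabla)}(\mathcal{M}',w')$ means that the two pointed models satisfy the same $\mathcal{L}(\nabla)$-formulas. For $X\subseteq S$, $m_\Delta(X)=\{s\in S\mid\text{for all }t,u,\text{ if }Rst\text{ and }Rsu,\text{ then }(t\in X\text{ iff }u\in X)\}$. Ultrafilter extension ($\forall$-version):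 $ue(\mathcal{M})=\langle Uf(S),R^{ue},V^{ue}\rangle$, where $Uf(S)$ is the set of all ultrafilters over $S$; $R^{ue}st$ iff for all $Y\subseteq S$, if $m_\Delta(X\cup Y)\in s$ for all $X\subseteq S$, then $Y\in t$; and $V^{ue}(p)=\{s\in Uf(S)\mid V(p)\in s\}$. For $w\in S$, $\pi_w=\{X\subseteq S\mid w\in X\}$. $\Delta$-bisimulation: a nonempty binary relation $Z$ on the domain of a Kripke model is a $\Delta$-bisimulation on that model if whenever $sZs'$: (Inv) $s$ and $s'$ satisfy the same propositional variables; ($\Delta$-Zig) if there are two different successors $t_1,t_2$ of $s$ with $(t_1,t_2)\notin Z$, and $Rst$, then there is $t'$ with $Rs't'$ and $tZt'$; ($\Delta$-Zag) if there are two different successors $t_1',t_2'$ of $s'$ with $(t_1',t_2')\notin Z$, and $Rs't'$, then there is $t$ with $Rst$ and $tZt'$. $(\mathcal{N},s)\mathrel{\underline{\leftrightarrow}}_\Delta(\mathcal{N}',s')$ means that there is a $\Delta$-bisimulation $Z$ on the disjoint union of $\mathcal{N}$ and $\mathcal{N}'$ with $sZs'$. *)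

theory Defs
  imports Main
begin

datatype 'p fm =
    Atom 'p
  | Neg "'p fm"
  | Conj "'p fm" "'p fm"
  | Nabla "'p fm"

abbreviation Delta :: "'p fm \<Rightarrow> 'p fm" where
  "Delta \<phi> \<equiv> Neg (Nabla \<phi>)"

record ('p, 'w) kripke =
  states :: "'w set"
  acc :: "('w \<times> 'w) set"
  val :: "'p \<Rightarrow> 'w set"

definition kripke_model :: "('p, 'w) kripke \<Rightarrow> bool" where
  "kripke_model M \<longleftrightarrow>
     states M \<noteq> {} \<and> acc M \<subseteq> states M \<times> states M \<and> (\<forall>p. val M p \<subseteq> states M)"

primrec sat :: "('p, 'w) kripke \<Rightarrow> 'w \<Rightarrow> 'p fm \<Rightarrow> bool" where
  "sat M s (Atom p) \<longleftrightarrow> s \<in> val M p"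
| "sat M s (Neg \<phi>) \<longleftrightarrow> \<not> sat M s \<phi>"
| "sat M s (Conj \<phi> \<psi>) \<longleftrightarrow> sat M s \<phi> \<and> sat M s \<psi>"
| "sat M s (Nabla \<phi>) \<longleftrightarrow>
     (\<exists>t\<in>states M. \<exists>u\<in>states M. (s, t) \<in> acc M \<and> (s, u) \<in> acc M \<and> sat M t \<phi> \<and> \<not> sat M u \<phi>)"

definition nabla_equiv ::
  "('p, 'a) kripke \<Rightarrow> 'a \<Rightarrow> ('p, 'b) kripke \<Rightarrow> 'b \<Rightarrow> bool" where
  "nabla_equiv M s M' s' \<longleftrightarrow> (\<forall>\<phi>. sat M s \<phi> \<longleftrightarrow> sat M' s' \<phi>)"

definition m_Delta :: "('p, 'w) kripke \<Rightarrow> 'w set \<Rightarrow> 'w set" where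
  "m_Delta M X =
     {s \<in> states M. \<forall>t u. (s, t) \<in> acc M \<and> (s, u) \<in> acc M \<longrightarrow> (t \<in> X \<longleftrightarrow> u \<in> X)}"

lemma m_Delta_truth_set:
  assumes "kripke_model M"
  shows "m_Delta M {s \<in> states M. sat M s \<phi>} = {s \<in> states M. sat M s (Delta \<phi>)}"
  using assms by (fastforce simp: m_Delta_def kripke_model_def)

definition ultrafilter_over :: "'w set \<Rightarrow> 'w set set \<Rightarrow> bool" where
  "ultrafilter_over S F \<longleftrightarrow>
     F \<subseteq> Pow S \<and>
     S \<in> F \<and>
     {} \<notin> F \<and>
     (\<forall>X\<in>F. \<forall>Y\<in>F. X \<inter> Y \<in> F) \<and>
     (\<forall>X\<in>F. \<forall>Y. X \<subseteq> Y \<and> Y \<subseteq> S \<longrightarrow> Y \<in> F) \<and>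
     (\<forall>X. X \<subseteq> S \<longrightarrow> X \<in> F \<or> S - X \<in> F)"

definition pi_uf :: "'w set \<Rightarrow> 'w \<Rightarrow> 'w set set" where
  "pi_uf S w = {X. X \<subseteq> S \<and> w \<in> X}"

definition ue :: "('p, 'w) kripke \<Rightarrow> ('p, 'w set set) kripke" where
  "ue M =
     \<lparr>states = {s. ultrafilter_over (states M) s},
      acc = {(s, t). ultrafilter_over (states M) s \<and> ultrafilter_over (states M) t \<and>
        (\<forall>Y. Y \<subseteq> states M \<longrightarrow>
           (\<forall>X. X \<subseteq> states M \<longrightarrow> m_Delta M (X \<union> Y) \<in> s) \<longrightarrow> Y \<in> t)},
      val = (\<lambda>p. {s. ultrafilter_over (states M) s \<and> val M p \<in> s})\<rparr>"

definition disjoint_union ::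
  "('p, 'a) kripke \<Rightarrow> ('p, 'b) kripke \<Rightarrow> ('p, 'a + 'b) kripke" where
  "disjoint_union N N' =
     \<lparr>states = Inl ` states N \<union> Inr ` states N',
      acc = {(Inl s, Inl t) | s t. (s, t) \<in> acc N} \<union> {(Inr s, Inr t) | s t. (s, t) \<in> acc N'},
      val = (\<lambda>p. Inl ` val N p \<union> Inr ` val N' p)\<rparr>"

(* Z need not be reflexive, so t1 \<noteq> t2 does not follow from (t1, t2) \<notin> Z. *)
definition delta_bisimulation :: "('p, 'w) kripke \<Rightarrow> ('w \<times> 'w) set \<Rightarrow> bool" where
  "delta_bisimulation M Z \<longleftrightarrow>
     Z \<noteq> {} \<and> Z \<subseteq> states M \<times> states M \<and>
     (\<forall>s s'. (s, s') \<in> Z \<longrightarrow>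
        (\<forall>p. s \<in> val M p \<longleftrightarrow> s' \<in> val M p) \<and>
        ((\<exists>t1 t2. (s, t1) \<in> acc M \<and> (s, t2) \<in> acc M \<and> t1 \<noteq> t2 \<and> (t1, t2) \<notin> Z) \<longrightarrow>
           (\<forall>t. (s, t) \<in> acc M \<longrightarrow> (\<exists>t'. (s', t') \<in> acc M \<and> (t, t') \<in> Z))) \<and>
        ((\<exists>t1' t2'. (s', t1') \<in> acc M \<and> (s', t2') \<in> acc M \<and> t1' \<noteq> t2' \<and> (t1', t2') \<notin> Z) \<longrightarrow>
           (\<forall>t'. (s', t') \<in> acc M \<longrightarrow> (\<exists>t. (s, t) \<in> acc M \<and> (t, t') \<in> Z))))"

definition delta_bisimilar ::
  "('p, 'a) kripke \<Rightarrow> 'a \<Rightarrow> ('p, 'b) kripke \<Rightarrow> 'b \<Rightarrow> bool" where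
  "delta_bisimilar N s N' s' \<longleftrightarrow>
     (\<exists>Z. delta_bisimulation (disjoint_union N N') Z \<and> (Inl s, Inr s') \<in> Z)"

lemma ultrafilter_pi_uf:
  "w \<in> S \<Longrightarrow> ultrafilter_over S (pi_uf S w)"
  by (auto simp: ultrafilter_over_def pi_uf_def)

lemma kripke_model_ue:
  assumes "kripke_model M"
  shows "kripke_model (ue M)"
proof -
  obtain w where "w \<in> states M" using assms by (auto simp: kripke_model_def)
  then have "pi_uf (states M) w \<in> states (ue M)"
    by (simp add: ue_def ultrafilter_pi_uf)
  then show ?thesis by (auto simp: kripke_model_def ue_def)
qed

lemma kripke_model_disjoint_union:
  "kripke_model N \<Longrightarrow> kripke_model N' \<Longrightarrow> kripke_model (disjoint_union N N')"
  by (fastforce simp: kripke_model_def disjoint_union_def)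

end

theory Submission
  imports Defs
begin

text \<open>
  The right-to-left direction rests on two invariance facts: a \<open>\<Delta>\<close>-bisimulation preserves
  all formulas (\<open>delta_bisimulation_preserves_sat\<close>), and a principal ultrafilter
  \<open>pi_uf (states M) w\<close> satisfies in \<open>ue M\<close> exactly the formulas that \<open>w\<close> satisfies in \<open>M\<close>,
  a consequence of the truth lemma \<open>sat_ue_iff\<close>: a formula holds at an ultrafilter iff its truth
  set belongs to it.

  The truth lemma needs to know what the accessibility relation of \<open>ue M\<close> looks like. The sets
  \<open>Y\<close> with \<open>m_Delta M (X \<union> Y) \<in> u\<close> for all \<open>X\<close> form a (possibly improper) filter \<open>necessary_sets M u\<close>, and the
  successors of \<open>u\<close> are exactly the ultrafilters that include it. A world at which \<open>A\<close> is not
  contingent has all its successors inside \<open>A\<close> or all inside the complement, so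
  \<open>m_Delta M A \<in> u\<close> holds iff \<open>A\<close> or its complement is in that filter, that is, iff all
  successors of \<open>u\<close> agree on \<open>A\<close>. The ultrafilter theorem supplies successors that disagree when
  this fails.

  For the left-to-right direction, the ultrafilter theorem also gives a saturation property: if
  \<open>\<Gamma>\<close> is nonempty and closed under conjunction and each \<open>\<phi> \<in> \<Gamma>\<close> has some \<open>\<psi>\<close> with \<open>\<nabla>(\<phi> \<and> \<psi>)\<close> true at
  \<open>u\<close>, then one successor of \<open>u\<close> satisfies all of \<open>\<Gamma>\<close>. The hypothesis \<open>\<nabla>(\<phi> \<and> \<psi>)\<close> is the
  contingency-language substitute for \<open>\<diamond>\<phi>\<close>. The property survives disjoint unions, and in a model that
  has it, equivalence of states is itself a \<open>\<Delta>\<close>-bisimulation. The Zig condition has to be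
  verified only at states with two inequivalent successors, which is precisely what makes the
  formulas \<open>\<nabla>(\<phi> \<and> \<psi>)\<close> available.
\<close>

section \<open>Invariance under bisimulations and disjoint unions\<close>

lemma sat_Nabla_iff:
  assumes "kripke_model K"
  shows "sat K s (Nabla \<phi>) \<longleftrightarrow>
    (\<exists>t u. (s, t) \<in> acc K \<and> (s, u) \<in> acc K \<and> sat K t \<phi> \<and> \<not> sat K u \<phi>)"
  using assms by (auto simp: kripke_model_def)

text \<open>
  Two successors that disagree on \<open>\<phi>\<close> are distinct, and by the induction hypothesis they are not
  related by \<open>Z\<close>. So the premise of Zig (or Zag) is met, and both can be matched.
\<close>

lemma delta_bisimulation_preserves_sat:
  assumes K: "kripke_model K" and Z: "delta_bisimulation K Z" and "(s, s') \<in> Z"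
  shows "sat K s \<phi> \<longleftrightarrow> sat K s' \<phi>"
  using \<open>(s, s') \<in> Z\<close>
proof (induction \<phi> arbitrary: s s')
  case (Atom p)
  then show ?case using Z by (simp add: delta_bisimulation_def)
next
  case (Nabla \<phi>)
  have zig: "\<exists>t'. (s', t') \<in> acc K \<and> (t, t') \<in> Z"
    if "(s, t1) \<in> acc K" "(s, t2) \<in> acc K" "t1 \<noteq> t2" "(t1, t2) \<notin> Z" "(s, t) \<in> acc K" for t1 t2 t
    using Z Nabla.prems that unfolding delta_bisimulation_def by blast
  have zag: "\<exists>t. (s, t) \<in> acc K \<and> (t, t') \<in> Z"
    if "(s', t1) \<in> acc K" "(s', t2) \<in> acc K" "t1 \<noteq> t2" "(t1, t2) \<notin> Z" "(s', t') \<in> acc K"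
    for t1 t2 t'
    using Z Nabla.prems that unfolding delta_bisimulation_def by blast
  show ?case
  proof
    assume "sat K s (Nabla \<phi>)"
    then obtain t u where tu: "(s, t) \<in> acc K" "(s, u) \<in> acc K" "sat K t \<phi>" "\<not> sat K u \<phi>"
      unfolding sat_Nabla_iff[OF K] by blast
    then have "(t, u) \<notin> Z" "t \<noteq> u" using Nabla.IH by auto
    then obtain t' u' where "(s', t') \<in> acc K" "(t, t') \<in> Z" "(s', u') \<in> acc K" "(u, u') \<in> Z"
      using zig tu by blast
    then show "sat K s' (Nabla \<phi>)" unfolding sat_Nabla_iff[OF K] using tu Nabla.IH by blast
  next
    assume "sat K s' (Nabla \<phi>)"
    then obtain t u where tu: "(s', t) \<in> acc K" "(s', u) \<in> acc K" "sat K t \<phi>" "\<not> sat K u \<phi>"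
      unfolding sat_Nabla_iff[OF K] by blast
    then have "(t, u) \<notin> Z" "t \<noteq> u" using Nabla.IH by auto
    then obtain t' u' where "(s, t') \<in> acc K" "(t', t) \<in> Z" "(s, u') \<in> acc K" "(u', u) \<in> Z"
      using zag tu by blast
    then show "sat K s (Nabla \<phi>)" unfolding sat_Nabla_iff[OF K] using tu Nabla.IH by blast
  qed
qed auto

lemma sat_disjoint_union_Inl: "sat (disjoint_union N N') (Inl s) \<phi> \<longleftrightarrow> sat N s \<phi>"
  by (induction \<phi> arbitrary: s) (auto simp: disjoint_union_def)

lemma sat_disjoint_union_Inr: "sat (disjoint_union N N') (Inr s) \<phi> \<longleftrightarrow> sat N' s \<phi>"
  by (induction \<phi> arbitrary: s) (auto simp: disjoint_union_def)

lemma acc_disjoint_union_Inl: "(Inl s, Inl t) \<in> acc (disjoint_union N N') \<longleftrightarrow> (s, t) \<in> acc N"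
  by (auto simp: disjoint_union_def)

lemma acc_disjoint_union_Inr: "(Inr s, Inr t) \<in> acc (disjoint_union N N') \<longleftrightarrow> (s, t) \<in> acc N'"
  by (auto simp: disjoint_union_def)

section \<open>Contingency-saturated models\<close>

text \<open>
  A set of formulas closed under conjunction is finitely realised as soon as each single member
  is. Since \<open>\<diamond>\<phi>\<close> is not expressible, realisability of \<open>\<phi>\<close> among the successors of \<open>s\<close> is
  witnessed by some true \<open>\<nabla>(\<phi> \<and> \<psi>)\<close>.
\<close>

definition nabla_saturated :: "('p, 'w) kripke \<Rightarrow> bool" where
  "nabla_saturated K \<longleftrightarrow>
     (\<forall>s\<in>states K. \<forall>\<Gamma>. \<Gamma> \<noteq> {} \<longrightarrow> (\<forall>\<phi>\<in>\<Gamma>. \<forall>\<psi>\<in>\<Gamma>. Conj \<phi> \<psi> \<in> \<Gamma>) \<longrightarrow>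
        (\<forall>\<phi>\<in>\<Gamma>. \<exists>\<psi>. sat K s (Nabla (Conj \<phi> \<psi>))) \<longrightarrow>
        (\<exists>t. (s, t) \<in> acc K \<and> (\<forall>\<phi>\<in>\<Gamma>. sat K t \<phi>)))"

lemma nabla_saturatedD:
  assumes "nabla_saturated K" "s \<in> states K" "\<Gamma> \<noteq> {}"
    and "\<And>\<phi> \<psi>. \<phi> \<in> \<Gamma> \<Longrightarrow> \<psi> \<in> \<Gamma> \<Longrightarrow> Conj \<phi> \<psi> \<in> \<Gamma>"
    and "\<And>\<phi>. \<phi> \<in> \<Gamma> \<Longrightarrow> \<exists>\<psi>. sat K s (Nabla (Conj \<phi> \<psi>))"
  shows "\<exists>t. (s, t) \<in> acc K \<and> (\<forall>\<phi>\<in>\<Gamma>. sat K t \<phi>)"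
  by (rule assms(1)[unfolded nabla_saturated_def, rule_format, OF assms(2,3)])
    (simp_all add: assms(4,5) del: sat.simps)

lemma nabla_saturated_disjoint_union:
  assumes N: "nabla_saturated N" and N': "nabla_saturated N'"
  shows "nabla_saturated (disjoint_union N N')"
  unfolding nabla_saturated_def
proof (intro ballI allI impI)
  let ?D = "disjoint_union N N'"
  fix s and \<Gamma> :: "'a fm set"
  assume s: "s \<in> states ?D" and ne: "\<Gamma> \<noteq> {}" and conj: "\<forall>\<phi>\<in>\<Gamma>. \<forall>\<psi>\<in>\<Gamma>. Conj \<phi> \<psi> \<in> \<Gamma>"
    and wit: "\<forall>\<phi>\<in>\<Gamma>. \<exists>\<psi>. sat ?D s (Nabla (Conj \<phi> \<psi>))"
  show "\<exists>t. (s, t) \<in> acc ?D \<and> (\<forall>\<phi>\<in>\<Gamma>. sat ?D t \<phi>)"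
  proof (cases s)
    case (Inl a)
    have "a \<in> states N" using s Inl by (auto simp: disjoint_union_def)
    moreover have "\<exists>\<psi>. sat N a (Nabla (Conj \<phi> \<psi>))" if "\<phi> \<in> \<Gamma>" for \<phi>
      using wit that unfolding Inl sat_disjoint_union_Inl by blast
    ultimately obtain t where "(a, t) \<in> acc N" "\<forall>\<phi>\<in>\<Gamma>. sat N t \<phi>"
      using nabla_saturatedD[OF N _ ne, of a] conj by metis
    then have "(s, Inl t) \<in> acc ?D" "\<forall>\<phi>\<in>\<Gamma>. sat ?D (Inl t) \<phi>"
      using Inl by (simp_all only: acc_disjoint_union_Inl sat_disjoint_union_Inl)
    then show ?thesis by blast
  next
    case (Inr a)
    have "a \<in> states N'" using s Inr by (auto simp: disjoint_union_def)
    moreover have "\<exists>\<psi>. sat N' a (Nabla (Conj \<phi> \<psi>))" if "\<phi> \<in> \<Gamma>" for \<phi>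
      using wit that unfolding Inr sat_disjoint_union_Inr by blast
    ultimately obtain t where "(a, t) \<in> acc N'" "\<forall>\<phi>\<in>\<Gamma>. sat N' t \<phi>"
      using nabla_saturatedD[OF N' _ ne, of a] conj by metis
    then have "(s, Inr t) \<in> acc ?D" "\<forall>\<phi>\<in>\<Gamma>. sat ?D (Inr t) \<phi>"
      using Inr by (simp_all only: acc_disjoint_union_Inr sat_disjoint_union_Inr)
    then show ?thesis by blast
  qed
qed

text \<open>
  Saturation at \<open>s'\<close> is applied to the theory of \<open>t\<close>, and the formulas \<open>\<nabla>(\<phi> \<and> \<psi>)\<close> are
  transferred from \<open>s\<close>. If \<open>\<phi>\<close> fails at some successor of \<open>s\<close>, then \<open>\<phi>\<close> is contingent there;
  otherwise \<open>\<phi>\<close> holds at all successors, and \<open>\<phi> \<and> \<chi>\<close> is contingent for any \<open>\<chi>\<close> on which two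
  successors disagree.
\<close>

lemma nabla_equiv_zig:
  assumes K: "kripke_model K" and sat: "nabla_saturated K" and s': "s' \<in> states K"
    and eq: "nabla_equiv K s K s'"
    and t12: "(s, t1) \<in> acc K" "(s, t2) \<in> acc K" "\<not> nabla_equiv K t1 K t2"
    and t: "(s, t) \<in> acc K"
  shows "\<exists>t'. (s', t') \<in> acc K \<and> nabla_equiv K t K t'"
proof -
  obtain \<chi> where "sat K t1 \<chi> \<noteq> sat K t2 \<chi>"
    using t12(3) unfolding nabla_equiv_def by metis
  then obtain a b where \<chi>: "(s, a) \<in> acc K" "(s, b) \<in> acc K" "sat K a \<chi>" "\<not> sat K b \<chi>"
    using t12(1,2) by metis
  let ?\<Gamma> = "{\<phi>. sat K t \<phi>}"
  have "\<exists>\<psi>. sat K s' (Nabla (Conj \<phi> \<psi>))" if "sat K t \<phi>" for \<phi>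
  proof (cases "\<exists>v. (s, v) \<in> acc K \<and> \<not> sat K v \<phi>")
    case True
    then have "sat K s (Nabla (Conj \<phi> \<phi>))" unfolding sat_Nabla_iff[OF K] using t that by auto
    then show ?thesis using eq unfolding nabla_equiv_def by metis
  next
    case False
    then have "sat K s (Nabla (Conj \<phi> \<chi>))" unfolding sat_Nabla_iff[OF K] using \<chi> by auto
    then show ?thesis using eq unfolding nabla_equiv_def by metis
  qed
  moreover have "?\<Gamma> \<noteq> {}"
  proof -
    have "sat K t (Neg (Conj \<chi> (Neg \<chi>)))" by simp
    then show ?thesis by blast
  qed
  ultimately obtain t' where t': "(s', t') \<in> acc K" "\<forall>\<phi>\<in>?\<Gamma>. sat K t' \<phi>"
    using nabla_saturatedD[OF sat s', of ?\<Gamma>] by auto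
  \<comment> \<open>Satisfying the whole theory of \<open>t\<close> already forces equivalence, because that theory
     contains \<open>\<not>\<phi>\<close> whenever \<open>\<phi>\<close> fails at \<open>t\<close>.\<close>
  have "sat K t \<phi> \<longleftrightarrow> sat K t' \<phi>" for \<phi>
    using bspec[OF t'(2), of \<phi>] bspec[OF t'(2), of "Neg \<phi>"] by auto
  then show ?thesis using t'(1) unfolding nabla_equiv_def by blast
qed

text \<open>A Hennessy--Milner property. Zag follows from Zig because the relation is symmetric.\<close>

lemma delta_bisimulation_nabla_equiv:
  assumes K: "kripke_model K" and sat: "nabla_saturated K"
  shows "delta_bisimulation K {(s, s'). s \<in> states K \<and> s' \<in> states K \<and> nabla_equiv K s K s'}"
    (is "delta_bisimulation K ?Z")
proof -
  have in_states: "\<And>a b. (a, b) \<in> acc K \<Longrightarrow> b \<in> states K"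
    using K by (auto simp: kripke_model_def)
  have sym: "nabla_equiv K a K b \<longleftrightarrow> nabla_equiv K b K a" for a b
    by (auto simp: nabla_equiv_def)
  show ?thesis
    unfolding delta_bisimulation_def
  proof (intro conjI allI impI)
    show "?Z \<noteq> {}"
      using K by (auto simp: kripke_model_def nabla_equiv_def)
    show "?Z \<subseteq> states K \<times> states K" by blast
  next
    fix s s' p assume "(s, s') \<in> ?Z"
    then have "sat K s (Atom p) \<longleftrightarrow> sat K s' (Atom p)"
      unfolding nabla_equiv_def by blast
    then show "s \<in> val K p \<longleftrightarrow> s' \<in> val K p" by simp
  next
    fix s s' t assume s: "(s, s') \<in> ?Z" and t: "(s, t) \<in> acc K"
      and "\<exists>t1 t2. (s, t1) \<in> acc K \<and> (s, t2) \<in> acc K \<and> t1 \<noteq> t2 \<and> (t1, t2) \<notin> ?Z"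
    then obtain t1 t2 where "(s, t1) \<in> acc K" "(s, t2) \<in> acc K" "\<not> nabla_equiv K t1 K t2"
      using in_states by blast
    then obtain t' where "(s', t') \<in> acc K" "nabla_equiv K t K t'"
      using nabla_equiv_zig[OF K sat, of s' s] s t by blast
    then show "\<exists>t'. (s', t') \<in> acc K \<and> (t, t') \<in> ?Z" using in_states t by blast
  next
    fix s s' t' assume s: "(s, s') \<in> ?Z" and t': "(s', t') \<in> acc K"
      and "\<exists>t1' t2'. (s', t1') \<in> acc K \<and> (s', t2') \<in> acc K \<and> t1' \<noteq> t2' \<and> (t1', t2') \<notin> ?Z"
    then obtain t1 t2 where "(s', t1) \<in> acc K" "(s', t2) \<in> acc K" "\<not> nabla_equiv K t1 K t2"
      using in_states by blast
    moreover have "nabla_equiv K s' K s" "s \<in> states K" using s sym by blast+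
    ultimately obtain t where "(s, t) \<in> acc K" "nabla_equiv K t' K t"
      using nabla_equiv_zig[OF K sat, of s s'] t' by blast
    then show "\<exists>t. (s, t) \<in> acc K \<and> (t, t') \<in> ?Z" using in_states t' sym by blast
  qed
qed

section \<open>Existence of ultrafilters\<close>

text \<open>
  Zorn's lemma is applied to families that are merely closed under intersection and omit
  \<open>{}\<close>. Maximality yields a set in \<open>U\<close> disjoint from any given set outside \<open>U\<close>, and upward closure
  and the ultra property both follow from that.
\<close>

lemma ultrafilter_extending_base:
  assumes "B \<subseteq> Pow S" "S \<in> B" "{} \<notin> B" "\<And>X Y. X \<in> B \<Longrightarrow> Y \<in> B \<Longrightarrow> X \<inter> Y \<in> B"
  shows "\<exists>U. ultrafilter_over S U \<and> B \<subseteq> U"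
proof -
  define \<F> where "\<F> = {G. B \<subseteq> G \<and> G \<subseteq> Pow S \<and> {} \<notin> G \<and> (\<forall>X\<in>G. \<forall>Y\<in>G. X \<inter> Y \<in> G)}"
  have "\<exists>U\<in>\<F>. \<forall>G\<in>\<F>. U \<subseteq> G \<longrightarrow> G = U"
  proof (rule subset_Zorn_nonempty)
    have "B \<in> \<F>" using assms unfolding \<F>_def by simp
    then show "\<F> \<noteq> {}" by blast
  next
    fix \<C> assume ne: "\<C> \<noteq> {}" and chain: "subset.chain \<F> \<C>"
    have sub: "\<C> \<subseteq> \<F>" using chain by (simp add: subset_chain_def)
    have "X \<inter> Y \<in> \<Union>\<C>" if XY: "X \<in> \<Union>\<C>" "Y \<in> \<Union>\<C>" for X Y
    proof -
      obtain G H where GH: "G \<in> \<C>" "X \<in> G" "H \<in> \<C>" "Y \<in> H" using XY by blast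
      then have "G \<subseteq> H \<or> H \<subseteq> G" using chain unfolding subset_chain_def by blast
      moreover have "\<forall>X\<in>G. \<forall>Y\<in>G. X \<inter> Y \<in> G" "\<forall>X\<in>H. \<forall>Y\<in>H. X \<inter> Y \<in> H"
        using GH sub unfolding \<F>_def by auto
      ultimately show ?thesis using GH by blast
    qed
    moreover have "B \<subseteq> \<Union>\<C>" using ne sub unfolding \<F>_def by blast
    moreover have "\<Union>\<C> \<subseteq> Pow S" "{} \<notin> \<Union>\<C>" using sub unfolding \<F>_def by blast+
    ultimately show "\<Union>\<C> \<in> \<F>" unfolding \<F>_def by blast
  qed
  then obtain U where "U \<in> \<F>" and max: "\<And>G. G \<in> \<F> \<Longrightarrow> U \<subseteq> G \<Longrightarrow> G = U" by blast
  then have U: "B \<subseteq> U" "U \<subseteq> Pow S" "{} \<notin> U" "\<And>X Y. X \<in> U \<Longrightarrow> Y \<in> U \<Longrightarrow> X \<inter> Y \<in> U"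
    unfolding \<F>_def by auto
  have S: "S \<in> U" using U(1) assms(2) by blast
  have disj: "\<exists>Y\<in>U. Y \<inter> X = {}" if X: "X \<subseteq> S" "X \<notin> U" for X
  proof (rule ccontr)
    assume no: "\<not> (\<exists>Y\<in>U. Y \<inter> X = {})"
    let ?G = "U \<union> (\<lambda>Y. Y \<inter> X) ` U"
    have "B \<subseteq> ?G" using U(1) by blast
    moreover have "P \<inter> Q \<in> ?G" if PQ: "P \<in> ?G" "Q \<in> ?G" for P Q
    proof -
      obtain P' Q' where P': "P' \<in> U" "P = P' \<or> P = P' \<inter> X" and Q': "Q' \<in> U" "Q = Q' \<or> Q = Q' \<inter> X"
        using PQ by blast
      have "P \<inter> Q = P' \<inter> Q' \<or> P \<inter> Q = P' \<inter> Q' \<inter> X" using P'(2) Q'(2) by auto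
      then show ?thesis using U(4)[OF P'(1) Q'(1)] by auto
    qed
    moreover have "?G \<subseteq> Pow S" using U(2) by blast
    moreover have "{} \<notin> ?G" using U(3) no by auto
    ultimately have "?G \<in> \<F>" unfolding \<F>_def by (intro CollectI conjI ballI)
    then have "?G = U" using max by blast
    moreover have "X \<in> ?G" using S X by (auto intro!: image_eqI[of _ _ S])
    ultimately show False using X by blast
  qed
  have up: "Y \<in> U" if XY: "X \<in> U" "X \<subseteq> Y" "Y \<subseteq> S" for X Y
  proof (rule ccontr)
    assume "Y \<notin> U"
    then obtain W where W: "W \<in> U" "W \<inter> Y = {}" using disj XY by blast
    then have "W \<inter> X = {}" using XY by blast
    then show False using U(3) U(4)[OF W(1) XY(1)] by simp
  qed
  have ultra: "X \<in> U \<or> S - X \<in> U" if X: "X \<subseteq> S" for X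
  proof (rule ccontr)
    assume "\<not> (X \<in> U \<or> S - X \<in> U)"
    then obtain P Q where PQ: "P \<in> U" "P \<inter> X = {}" "Q \<in> U" "Q \<inter> (S - X) = {}"
      using disj[of X] disj[of "S - X"] X by blast
    then have "P \<inter> Q = {}" using U(2) by blast
    then show False using U(3) U(4)[OF PQ(1,3)] by simp
  qed
  have "\<forall>X\<in>U. \<forall>Y\<in>U. X \<inter> Y \<in> U" using U(4) by simp
  moreover have "\<forall>X\<in>U. \<forall>Y. X \<subseteq> Y \<and> Y \<subseteq> S \<longrightarrow> Y \<in> U" using up by blast
  moreover have "\<forall>X. X \<subseteq> S \<longrightarrow> X \<in> U \<or> S - X \<in> U" using ultra by simp
  ultimately have "ultrafilter_over S U"
    unfolding ultrafilter_over_def using U(2,3) S by (intro conjI)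
  then show ?thesis using U(1) by blast
qed

lemma ultrafilter_extending_two_bases:
  assumes N: "N \<subseteq> Pow S" "S \<in> N" "\<And>X Y. X \<in> N \<Longrightarrow> Y \<in> N \<Longrightarrow> X \<inter> Y \<in> N"
    and C: "C \<subseteq> Pow S" "C \<noteq> {}" "\<And>X Y. X \<in> C \<Longrightarrow> Y \<in> C \<Longrightarrow> X \<inter> Y \<in> C"
    and meet: "\<And>X Y. X \<in> N \<Longrightarrow> Y \<in> C \<Longrightarrow> X \<inter> Y \<noteq> {}"
  shows "\<exists>U. ultrafilter_over S U \<and> N \<subseteq> U \<and> C \<subseteq> U"
proof -
  \<comment> \<open>With \<open>S\<close> in both families, the pairwise intersections form a base that includes each of them.\<close>
  let ?C = "insert S C"
  let ?B = "{X \<inter> Y | X Y. X \<in> N \<and> Y \<in> ?C}"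
  have C': "X \<inter> Y \<in> ?C" if XY: "X \<in> ?C" "Y \<in> ?C" for X Y
  proof -
    have "X \<subseteq> S" "Y \<subseteq> S" using XY C(1) by auto
    then show ?thesis using XY C(3) by (auto simp: Int_absorb1 Int_absorb2)
  qed
  have "\<exists>U. ultrafilter_over S U \<and> ?B \<subseteq> U"
  proof (rule ultrafilter_extending_base)
    show "?B \<subseteq> Pow S" using N(1) by blast
    show "S \<in> ?B" using N(2) by blast
    obtain Y where Y: "Y \<in> C" using C(2) by blast
    have "X \<noteq> {}" if "X \<in> N" for X using meet[OF that Y] by blast
    moreover have "X \<inter> S = X" if "X \<in> N" for X using N(1) that by blast
    ultimately have "X \<inter> Y \<noteq> {}" if "X \<in> N" "Y \<in> ?C" for X Y
      using meet that by (metis insertE)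
    then show "{} \<notin> ?B" by fastforce
  next
    fix P Q assume "P \<in> ?B" "Q \<in> ?B"
    then obtain X Y X' Y' where XY: "P = X \<inter> Y" "X \<in> N" "Y \<in> ?C" "Q = X' \<inter> Y'" "X' \<in> N" "Y' \<in> ?C"
      by blast
    then have "P \<inter> Q = (X \<inter> X') \<inter> (Y \<inter> Y')" by blast
    moreover have "X \<inter> X' \<in> N" "Y \<inter> Y' \<in> ?C" using N(3) C' XY by blast+
    ultimately show "P \<inter> Q \<in> ?B" by blast
  qed
  then obtain U where U: "ultrafilter_over S U" "?B \<subseteq> U" by blast
  have "X \<in> ?B" if "X \<in> N" for X
  proof -
    have "X = X \<inter> S" using that N(1) by blast
    then show ?thesis using that by blast
  qed
  moreover have "Y \<in> ?B" if "Y \<in> C" for Y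
  proof -
    have "Y = S \<inter> Y" using that C(1) by blast
    then show ?thesis using that N(2) by blast
  qed
  ultimately show ?thesis using U by blast
qed

lemma ultrafilter_Int: "ultrafilter_over S F \<Longrightarrow> X \<in> F \<Longrightarrow> Y \<in> F \<Longrightarrow> X \<inter> Y \<in> F"
  by (simp add: ultrafilter_over_def)

lemma ultrafilter_upward: "ultrafilter_over S F \<Longrightarrow> X \<in> F \<Longrightarrow> X \<subseteq> Y \<Longrightarrow> Y \<subseteq> S \<Longrightarrow> Y \<in> F"
  unfolding ultrafilter_over_def by blast

lemma ultrafilter_Diff_iff:
  assumes "ultrafilter_over S F" "X \<subseteq> S"
  shows "S - X \<in> F \<longleftrightarrow> X \<notin> F"
proof -
  have "X \<inter> (S - X) = {}" by blast
  then show ?thesis using assms unfolding ultrafilter_over_def by metis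
qed

lemma ultrafilter_Int_iff:
  assumes "ultrafilter_over S F" "X \<subseteq> S" "Y \<subseteq> S"
  shows "X \<inter> Y \<in> F \<longleftrightarrow> X \<in> F \<and> Y \<in> F"
proof -
  show ?thesis
    using ultrafilter_Int[OF assms(1)] ultrafilter_upward[OF assms(1)] assms(2,3)
    by (metis inf_le1 inf_le2)
qed

section \<open>Accessibility in the ultrafilter extension\<close>

lemma m_Delta_subset: "m_Delta M X \<subseteq> states M"
  by (auto simp: m_Delta_def)

lemma m_Delta_Diff: "kripke_model M \<Longrightarrow> m_Delta M (states M - X) = m_Delta M X"
  unfolding m_Delta_def kripke_model_def by blast

definition necessary_sets :: "('p, 'w) kripke \<Rightarrow> 'w set set \<Rightarrow> 'w set set" where
  "necessary_sets M u = {Y. Y \<subseteq> states M \<and> (\<forall>X. X \<subseteq> states M \<longrightarrow> m_Delta M (X \<union> Y) \<in> u)}"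

lemma acc_ue_iff:
  "(u, t) \<in> acc (ue M) \<longleftrightarrow>
     ultrafilter_over (states M) u \<and> ultrafilter_over (states M) t \<and> necessary_sets M u \<subseteq> t"
  by (auto simp: ue_def necessary_sets_def)

lemma necessary_sets_subset: "necessary_sets M u \<subseteq> Pow (states M)"
  by (auto simp: necessary_sets_def)

lemma necessary_sets_superset:
  assumes "Y \<in> necessary_sets M u" "Y \<subseteq> Y'" "Y' \<subseteq> states M"
  shows "Y' \<in> necessary_sets M u"
  unfolding necessary_sets_def
proof (intro CollectI conjI allI impI)
  fix X assume "X \<subseteq> states M"
  then have "X \<union> Y' \<subseteq> states M" using assms(3) by simp
  then have "m_Delta M ((X \<union> Y') \<union> Y) \<in> u"
    using assms(1) unfolding necessary_sets_def by simp
  moreover have "(X \<union> Y') \<union> Y = X \<union> Y'" using assms by blast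
  ultimately show "m_Delta M (X \<union> Y') \<in> u" by simp
qed (fact assms)

lemma states_in_necessary_sets:
  assumes M: "kripke_model M" and u: "ultrafilter_over (states M) u"
  shows "states M \<in> necessary_sets M u"
proof -
  have "m_Delta M (X \<union> states M) = states M" for X
    using M unfolding m_Delta_def kripke_model_def by blast
  then show ?thesis using u by (simp add: necessary_sets_def ultrafilter_over_def)
qed

text \<open>
  Union distributes over the intersection, and a world with neither \<open>A\<close> nor \<open>B\<close> contingent does
  not have \<open>A \<inter> B\<close> contingent.
\<close>

lemma necessary_sets_Int:
  assumes u: "ultrafilter_over (states M) u"
    and Y: "Y \<in> necessary_sets M u" and Y': "Y' \<in> necessary_sets M u"
  shows "Y \<inter> Y' \<in> necessary_sets M u"
  unfolding necessary_sets_def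
proof (intro CollectI conjI allI impI)
  fix X assume "X \<subseteq> states M"
  then have "m_Delta M (X \<union> Y) \<in> u" "m_Delta M (X \<union> Y') \<in> u"
    using Y Y' unfolding necessary_sets_def by blast+
  then have "m_Delta M (X \<union> Y) \<inter> m_Delta M (X \<union> Y') \<in> u"
    by (rule ultrafilter_Int[OF u])
  moreover have "m_Delta M (X \<union> Y) \<inter> m_Delta M (X \<union> Y') \<subseteq> m_Delta M (X \<union> Y \<inter> Y')"
    unfolding m_Delta_def by blast
  ultimately show "m_Delta M (X \<union> Y \<inter> Y') \<in> u"
    using ultrafilter_upward[OF u _ _ m_Delta_subset] by blast
qed (use Y in \<open>auto simp: necessary_sets_def\<close>)

text \<open>
  If \<open>A\<close> and \<open>- A\<close> both failed to be necessary, the ultrafilter would contain a set of worlds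
  that have no contingency about \<open>A\<close> and yet have successors outside \<open>A\<close> (contingency of some
  \<open>X \<union> A\<close>) as well as inside \<open>A\<close> (contingency of some \<open>X' \<union> - A\<close>).
\<close>

lemma m_Delta_in_ultrafilter_iff:
  assumes M: "kripke_model M" and u: "ultrafilter_over (states M) u" and A: "A \<subseteq> states M"
  shows "m_Delta M A \<in> u \<longleftrightarrow> A \<in> necessary_sets M u \<or> states M - A \<in> necessary_sets M u"
proof
  assume mA: "m_Delta M A \<in> u"
  show "A \<in> necessary_sets M u \<or> states M - A \<in> necessary_sets M u"
  proof (rule ccontr)
    assume "\<not> ?thesis"
    then obtain X X' where X: "m_Delta M (X \<union> A) \<notin> u" and X': "m_Delta M (X' \<union> (states M - A)) \<notin> u"
      using A unfolding necessary_sets_def by blast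
    have "states M - m_Delta M (X \<union> A) \<in> u" "states M - m_Delta M (X' \<union> (states M - A)) \<in> u"
      using X X' ultrafilter_Diff_iff[OF u m_Delta_subset] by blast+
    then have "m_Delta M A \<inter> ((states M - m_Delta M (X \<union> A)) \<inter>
        (states M - m_Delta M (X' \<union> (states M - A)))) \<in> u"
      by (intro ultrafilter_Int[OF u] mA)
    then have "m_Delta M A \<inter> ((states M - m_Delta M (X \<union> A)) \<inter>
        (states M - m_Delta M (X' \<union> (states M - A)))) \<noteq> {}"
      using u by (auto simp only: ultrafilter_over_def)
    then obtain s where s: "s \<in> states M" "s \<in> m_Delta M A" "s \<notin> m_Delta M (X \<union> A)"
        "s \<notin> m_Delta M (X' \<union> (states M - A))"
      by blast
    have succ: "t \<in> states M" if "(s, t) \<in> acc M" for t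
      using M that by (auto simp: kripke_model_def)
    obtain t where t: "(s, t) \<in> acc M" "t \<notin> A" using s(1,3) unfolding m_Delta_def by blast
    obtain v where v: "(s, v) \<in> acc M" "v \<in> A" using s(1,4) succ unfolding m_Delta_def by blast
    show False using s(2) t v unfolding m_Delta_def by blast
  qed
next
  have *: "m_Delta M Y \<in> u" if "Y \<in> necessary_sets M u" for Y
  proof -
    have "m_Delta M ({} \<union> Y) \<in> u" using that unfolding necessary_sets_def by blast
    then show ?thesis by simp
  qed
  assume "A \<in> necessary_sets M u \<or> states M - A \<in> necessary_sets M u"
  then show "m_Delta M A \<in> u" using *[of A] *[of "states M - A"] m_Delta_Diff[OF M, of A] by auto
qed

text \<open>
  The necessary sets are closed under supersets, so one of them misses \<open>A\<close> only if the complement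
  of \<open>A\<close> is necessary itself.
\<close>

lemma successor_extending_base:
  assumes M: "kripke_model M" and u: "ultrafilter_over (states M) u"
    and C: "C \<subseteq> Pow (states M)" "C \<noteq> {}" "\<And>X Y. X \<in> C \<Longrightarrow> Y \<in> C \<Longrightarrow> X \<inter> Y \<in> C"
    and poss: "\<And>A. A \<in> C \<Longrightarrow> states M - A \<notin> necessary_sets M u"
  shows "\<exists>t. (u, t) \<in> acc (ue M) \<and> C \<subseteq> t"
proof -
  have meet: "X \<inter> A \<noteq> {}" if "X \<in> necessary_sets M u" "A \<in> C" for X A
  proof
    assume "X \<inter> A = {}"
    then have "X \<subseteq> states M - A" using that necessary_sets_subset by blast
    then show False using necessary_sets_superset that poss by blast
  qed
  have "\<exists>t. ultrafilter_over (states M) t \<and> necessary_sets M u \<subseteq> t \<and> C \<subseteq> t"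
    by (rule ultrafilter_extending_two_bases)
      (fact necessary_sets_subset states_in_necessary_sets[OF M u] necessary_sets_Int[OF u] C meet)+
  then show ?thesis using u acc_ue_iff by blast
qed

lemma m_Delta_in_ultrafilter_iff_successors_agree:
  assumes M: "kripke_model M" and u: "ultrafilter_over (states M) u" and A: "A \<subseteq> states M"
  shows "m_Delta M A \<in> u \<longleftrightarrow>
    (\<forall>t v. (u, t) \<in> acc (ue M) \<and> (u, v) \<in> acc (ue M) \<longrightarrow> (A \<in> t \<longleftrightarrow> A \<in> v))"
proof
  assume "m_Delta M A \<in> u"
  then consider "A \<in> necessary_sets M u" | "states M - A \<in> necessary_sets M u"
    using m_Delta_in_ultrafilter_iff[OF assms] by blast
  then show "\<forall>t v. (u, t) \<in> acc (ue M) \<and> (u, v) \<in> acc (ue M) \<longrightarrow> (A \<in> t \<longleftrightarrow> A \<in> v)"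
  proof cases
    case 1
    then show ?thesis by (auto simp: acc_ue_iff)
  next
    case 2
    then have "A \<notin> t" if "(u, t) \<in> acc (ue M)" for t
      using that ultrafilter_Diff_iff[of "states M" t A] A unfolding acc_ue_iff by blast
    then show ?thesis by blast
  qed
next
  assume agree: "\<forall>t v. (u, t) \<in> acc (ue M) \<and> (u, v) \<in> acc (ue M) \<longrightarrow> (A \<in> t \<longleftrightarrow> A \<in> v)"
  have succ: "\<exists>t. (u, t) \<in> acc (ue M) \<and> B \<in> t"
    if "B \<subseteq> states M" "states M - B \<notin> necessary_sets M u" for B
    using successor_extending_base[OF M u, of "{B}"] that by auto
  show "m_Delta M A \<in> u"
  proof (rule ccontr)
    assume "m_Delta M A \<notin> u"
    then have n: "A \<notin> necessary_sets M u" "states M - A \<notin> necessary_sets M u"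
      using m_Delta_in_ultrafilter_iff[OF assms] by blast+
    obtain t where t: "(u, t) \<in> acc (ue M)" "A \<in> t" using succ[OF A n(2)] by blast
    have "states M - (states M - A) = A" using A by blast
    then obtain v where v: "(u, v) \<in> acc (ue M)" "states M - A \<in> v"
      using succ[of "states M - A"] n(1) by auto
    then have "A \<notin> v" using ultrafilter_Diff_iff[OF _ A] unfolding acc_ue_iff by blast
    then show False using agree t v by blast
  qed
qed

section \<open>Truth and saturation in the ultrafilter extension\<close>

definition truth_set :: "('p, 'w) kripke \<Rightarrow> 'p fm \<Rightarrow> 'w set" where
  "truth_set M \<phi> = {s \<in> states M. sat M s \<phi>}"

lemma truth_set_subset: "truth_set M \<phi> \<subseteq> states M"
  by (auto simp: truth_set_def)

lemma truth_set_Neg: "truth_set M (Neg \<phi>) = states M - truth_set M \<phi>"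
  by (auto simp: truth_set_def)

lemma truth_set_Conj: "truth_set M (Conj \<phi> \<psi>) = truth_set M \<phi> \<inter> truth_set M \<psi>"
  by (auto simp: truth_set_def)

lemma truth_set_Nabla:
  assumes "kripke_model M"
  shows "truth_set M (Nabla \<phi>) = states M - m_Delta M (truth_set M \<phi>)"
proof -
  have "m_Delta M (truth_set M \<phi>) = states M - truth_set M (Nabla \<phi>)"
    unfolding truth_set_Neg[symmetric] unfolding truth_set_def by (rule m_Delta_truth_set[OF assms])
  then show ?thesis using truth_set_subset[of M "Nabla \<phi>"] by (simp add: double_diff)
qed

lemma sat_ue_iff:
  assumes M: "kripke_model M" and "ultrafilter_over (states M) u"
  shows "sat (ue M) u \<phi> \<longleftrightarrow> truth_set M \<phi> \<in> u"
  using assms(2)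
proof (induction \<phi> arbitrary: u)
  case (Atom p)
  have "truth_set M (Atom p) = val M p" using M by (auto simp: truth_set_def kripke_model_def)
  then show ?case using Atom by (simp add: ue_def)
next
  case (Neg \<phi>)
  then show ?case by (simp add: truth_set_Neg ultrafilter_Diff_iff truth_set_subset)
next
  case (Conj \<phi> \<psi>)
  then show ?case by (simp add: truth_set_Conj ultrafilter_Int_iff truth_set_subset)
next
  case (Nabla \<phi>)
  have uf: "ultrafilter_over (states M) t" if "(u, t) \<in> acc (ue M)" for t
    using that by (simp add: acc_ue_iff)
  have "sat (ue M) u (Nabla \<phi>) \<longleftrightarrow>
      (\<exists>t v. (u, t) \<in> acc (ue M) \<and> (u, v) \<in> acc (ue M) \<and> truth_set M \<phi> \<in> t \<and> truth_set M \<phi> \<notin> v)"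
    unfolding sat_Nabla_iff[OF kripke_model_ue[OF M]] using Nabla.IH uf by blast
  also have "\<dots> \<longleftrightarrow> m_Delta M (truth_set M \<phi>) \<notin> u"
    using m_Delta_in_ultrafilter_iff_successors_agree[OF M Nabla.prems truth_set_subset, of \<phi>] by blast
  also have "\<dots> \<longleftrightarrow> truth_set M (Nabla \<phi>) \<in> u"
    by (simp add: truth_set_Nabla[OF M] ultrafilter_Diff_iff[OF Nabla.prems m_Delta_subset])
  finally show ?case .
qed

lemma sat_ue_pi_uf_iff:
  assumes M: "kripke_model M" and w: "w \<in> states M"
  shows "sat (ue M) (pi_uf (states M) w) \<phi> \<longleftrightarrow> sat M w \<phi>"
proof -
  have "truth_set M \<phi> \<in> pi_uf (states M) w \<longleftrightarrow> sat M w \<phi>"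
    using w truth_set_subset[of M \<phi>] by (simp add: pi_uf_def) (simp add: truth_set_def)
  then show ?thesis by (simp add: sat_ue_iff[OF M ultrafilter_pi_uf[OF w]])
qed

text \<open>
  If the complement of the truth set of \<open>\<phi>\<close> were necessary at \<open>u\<close>, then no \<open>\<phi> \<and> \<psi>\<close> could be
  contingent at \<open>u\<close>: its negation is a superset of that complement, hence necessary too. So the
  truth sets of \<open>\<Gamma>\<close> can be adjoined to the necessary sets.
\<close>

lemma nabla_saturated_ue:
  assumes M: "kripke_model M"
  shows "nabla_saturated (ue M)"
  unfolding nabla_saturated_def
proof (intro ballI allI impI)
  fix u and \<Gamma> :: "'a fm set"
  assume "u \<in> states (ue M)" and ne: "\<Gamma> \<noteq> {}" and conj: "\<forall>\<phi>\<in>\<Gamma>. \<forall>\<psi>\<in>\<Gamma>. Conj \<phi> \<psi> \<in> \<Gamma>"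
    and wit: "\<forall>\<phi>\<in>\<Gamma>. \<exists>\<psi>. sat (ue M) u (Nabla (Conj \<phi> \<psi>))"
  then have u: "ultrafilter_over (states M) u" by (simp add: ue_def)
  have poss: "states M - truth_set M \<phi> \<notin> necessary_sets M u" if mem: "\<phi> \<in> \<Gamma>" for \<phi>
  proof
    assume nec: "states M - truth_set M \<phi> \<in> necessary_sets M u"
    obtain \<psi> where \<psi>: "sat (ue M) u (Nabla (Conj \<phi> \<psi>))" using wit mem by blast
    have "states M - truth_set M (Conj \<phi> \<psi>) \<in> necessary_sets M u"
      by (rule necessary_sets_superset[OF nec]) (auto simp: truth_set_Conj)
    then have "m_Delta M (truth_set M (Conj \<phi> \<psi>)) \<in> u"
      using m_Delta_in_ultrafilter_iff[OF M u truth_set_subset] by blast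
    then show False
      using \<psi> unfolding sat_ue_iff[OF M u] truth_set_Nabla[OF M]
      using ultrafilter_Diff_iff[OF u m_Delta_subset] by blast
  qed
  have "\<exists>t. (u, t) \<in> acc (ue M) \<and> truth_set M ` \<Gamma> \<subseteq> t"
  proof (rule successor_extending_base[OF M u])
    show "truth_set M ` \<Gamma> \<subseteq> Pow (states M)" by (auto simp: truth_set_def)
    show "truth_set M ` \<Gamma> \<noteq> {}" using ne by simp
    show "X \<inter> Y \<in> truth_set M ` \<Gamma>" if "X \<in> truth_set M ` \<Gamma>" "Y \<in> truth_set M ` \<Gamma>" for X Y
      using that conj by (auto simp: truth_set_Conj[symmetric])
    show "states M - A \<notin> necessary_sets M u" if "A \<in> truth_set M ` \<Gamma>" for A
      using that poss by blast
  qed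
  then obtain t where t: "(u, t) \<in> acc (ue M)" "truth_set M ` \<Gamma> \<subseteq> t" by blast
  then have "\<forall>\<phi>\<in>\<Gamma>. sat (ue M) t \<phi>"
    using sat_ue_iff[OF M, of t] by (auto simp: acc_ue_iff)
  then show "\<exists>t. (u, t) \<in> acc (ue M) \<and> (\<forall>\<phi>\<in>\<Gamma>. sat (ue M) t \<phi>)" using t by blast
qed

section \<open>Equivalence as bisimilarity of ultrafilter extensions\<close>

theorem theorem26:
  fixes M :: "('p, 'a) kripke" and M' :: "('p, 'b) kripke"
    and w :: 'a and w' :: 'b
  assumes "kripke_model M" and "kripke_model M'"
    and "w \<in> states M" and "w' \<in> states M'"
  shows "nabla_equiv M w M' w' \<longleftrightarrow>
    delta_bisimilar (ue M) (pi_uf (states M) w) (ue M') (pi_uf (states M') w')"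
proof -
  let ?D = "disjoint_union (ue M) (ue M')"
  let ?s = "Inl (pi_uf (states M) w) :: 'a set set + 'b set set"
  let ?s' = "Inr (pi_uf (states M') w') :: 'a set set + 'b set set"
  have D: "kripke_model ?D"
    using assms by (intro kripke_model_disjoint_union kripke_model_ue)
  have eq: "nabla_equiv M w M' w' \<longleftrightarrow> nabla_equiv ?D ?s ?D ?s'"
    unfolding nabla_equiv_def sat_disjoint_union_Inl sat_disjoint_union_Inr
    using assms by (simp add: sat_ue_pi_uf_iff)
  show ?thesis
  proof
    assume "nabla_equiv M w M' w'"
    moreover have "?s \<in> states ?D" "?s' \<in> states ?D"
      using assms by (auto simp: disjoint_union_def ue_def ultrafilter_pi_uf)
    moreover have "nabla_saturated ?D"
      using assms by (intro nabla_saturated_disjoint_union nabla_saturated_ue)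
    ultimately show "delta_bisimilar (ue M) (pi_uf (states M) w) (ue M') (pi_uf (states M') w')"
      unfolding delta_bisimilar_def using delta_bisimulation_nabla_equiv[OF D] eq by blast
  next
    assume "delta_bisimilar (ue M) (pi_uf (states M) w) (ue M') (pi_uf (states M') w')"
    then obtain Z where "delta_bisimulation ?D Z" "(?s, ?s') \<in> Z"
      unfolding delta_bisimilar_def by blast
    then have "nabla_equiv ?D ?s ?D ?s'"
      unfolding nabla_equiv_def using delta_bisimulation_preserves_sat[OF D] by blast
    then show "nabla_equiv M w M' w'" using eq by blast
  qed
qed

end
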